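(* Consider a single DRCCP ($I=1$) with affine mappings $a_1(x)=x$ and $b_1(x)=b_1$ (a constant). Suppose that the deterministic set $\mathcal X\subseteq\mathbb{R}^n$ is convex, the reference distribution $\mathbb{P}_\zeta$ is continuous and nondegenerate with support $\mathbb{R}^n$, and $\|\cdot\|_*=\|\cdot\|_p$ with $p\in(1,\infty)$. Then the lower-level ALSO-X problem $$v^A(t)=\min_{x\in\mathcal X}\Big\{\mathbb{E}_{\mathbb{P}_\zeta}\big[(\theta\|x\|_*+x^\top\tilde\zeta-b_1)_+\big] : c^\top x\le t\Big\}$$ admits a unique optimal solution when $t\ge\min_{x\in\mathcal X}c^\top x$ and $v^A(t)>0$.
   Context: $c\in\mathbb{R}^n$, $b_1\in\mathbb{R}$, $\theta\ge0$, $(y)_+=\max\{y,0\}$; $\|\cdot\|_p$ is the $\ell_p$ norm on $\mathbb{R}^n$. $\tilde\zeta$ is a random vector in $\mathbb{R}^n$ with distribution $\mathbb{P}_\zeta$, assumed throughout to be sub-Gaussian: $\mathbb{P}_\zeta\{\|\tilde\zeta\|\ge\tau\}\le C_1\exp(-C_2\tau^2)$ for some constants $C_1,C_2>0$. "Continuous" means possessing a probability density; "nondegenerate" means not supported in a proper affine subspace. The problem above is the lower-level problem of the ALSO-X approximation of the distributionally robust chance constrained program $\min_{x\in\mathcal X}\{c^\top x:\mathbb{P}_\zeta\{\theta\|x\|_*+x^\top\tilde\zeta\le b_1\}\ge1-\varepsilon\}$ (type $\infty$-Wasserstein ambiguity set of radius $\theta$). Convention: the minimization problem is understood to attain its minimum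 whenever it is feasible. *)

theory Defs
  imports "HOL-Probability.Probability"
begin

definition lp_norm :: "real \<Rightarrow> real ^ 'n \<Rightarrow> real" where
  "lp_norm p x = (\<Sum>i\<in>UNIV. \<bar>x $ i\<bar> powr p) powr (1 / p)"

definition is_norm :: "('a::real_vector \<Rightarrow> real) \<Rightarrow> bool" where
  "is_norm N \<longleftrightarrow>
     (\<forall>x. N x = 0 \<longleftrightarrow> x = 0) \<and>
     (\<forall>r x. N (r *\<^sub>R x) = \<bar>r\<bar> * N x) \<and>
     (\<forall>x y. N (x + y) \<le> N x + N y)"

definition dual_norm :: "('a::real_inner \<Rightarrow> real) \<Rightarrow> 'a \<Rightarrow> real" where
  "dual_norm N x = (SUP z\<in>{z. N z \<le> 1}. x \<bullet> z)"

definition pos_part :: "real \<Rightarrow> real" where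
  "pos_part y = max y 0"

text \<open>Below, \<open>P\<close> is the distribution of the random vector, that is, a probability measure on
  the Borel sets.\<close>

definition sub_gaussian :: "('a::topological_space \<Rightarrow> real) \<Rightarrow> 'a measure \<Rightarrow> bool" where
  "sub_gaussian N P \<longleftrightarrow>
     (\<exists>C1>0. \<exists>C2>0. \<forall>\<tau>\<ge>0. measure P {z. N z \<ge> \<tau>} \<le> C1 * exp (- C2 * \<tau>\<^sup>2))"

definition has_probability_density :: "'a::euclidean_space measure \<Rightarrow> bool" where
  "has_probability_density P \<longleftrightarrow> (\<exists>f\<in>borel_measurable lborel. P = density lborel f)"

definition topological_support :: "'a::topological_space measure \<Rightarrow> 'a set" where
  "topological_support P = {z. \<forall>U. open U \<longrightarrow> z \<in> U \<longrightarrow> measure P U > 0}"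

definition nondegenerate :: "'a::euclidean_space measure \<Rightarrow> bool" where
  "nondegenerate P \<longleftrightarrow> \<not> (\<exists>A. affine A \<and> A \<noteq> UNIV \<and> (AE z in P. z \<in> A))"

text \<open>The value of a minimization problem is an extended real: \<open>\<infinity>\<close> if the problem is infeasible and
  \<open>-\<infinity>\<close> if it is unbounded.\<close>

definition min_value :: "('a \<Rightarrow> real) \<Rightarrow> 'a set \<Rightarrow> ereal" where
  "min_value f S = (INF x\<in>S. ereal (f x))"

text \<open>The convention that a feasible minimization problem which is bounded below attains its
  minimum.\<close>

definition attains_min :: "('a \<Rightarrow> real) \<Rightarrow> 'a set \<Rightarrow> bool" where
  "attains_min f S \<longleftrightarrow>
     (S \<noteq> {} \<and> min_value f S \<noteq> -\<infinity> \<longrightarrow> (\<exists>x. is_arg_min f (\<lambda>x. x \<in> S) x))"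

definition alsox_objective ::
    "('a::euclidean_space \<Rightarrow> real) \<Rightarrow> real \<Rightarrow> real \<Rightarrow> 'a measure \<Rightarrow> 'a \<Rightarrow> real" where
  "alsox_objective N \<theta> b1 P x =
     (\<integral>z. pos_part (\<theta> * dual_norm N x + x \<bullet> z - b1) \<partial>P)"

definition alsox_feasible :: "'a::real_inner \<Rightarrow> 'a set \<Rightarrow> real \<Rightarrow> 'a set" where
  "alsox_feasible c X t = {x \<in> X. c \<bullet> x \<le> t}"

definition alsox_value ::
    "('a::euclidean_space \<Rightarrow> real) \<Rightarrow> real \<Rightarrow> real \<Rightarrow> 'a measure \<Rightarrow> 'a \<Rightarrow> 'a set \<Rightarrow> real \<Rightarrow> ereal" where
  "alsox_value N \<theta> b1 P c X t = min_value (alsox_objective N \<theta> b1 P) (alsox_feasible c X t)"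

end

theory Submission
  imports Defs
begin

text \<open>
  Write \<open>g x z = \<theta> \<parallel>x\<parallel>\<^sub>* + x \<bullet> z - b1\<close>, so that the objective is the mean of the positive part of
  \<open>g x\<close>. It is convex in \<open>x\<close>, but for \<open>b1 = 0\<close> it is linear along every ray from the origin, so strict
  convexity is not available in general. Uniqueness comes from the full support of the random vector
  and, along rays, from the positivity of the optimal value.

  Let \<open>x\<close> and \<open>y\<close> be optimal. The midpoint is feasible, so it is optimal too and Jensen's inequality
  for the pair is an equality in the mean. It is then an equality almost everywhere, and since both
  sides are continuous in \<open>z\<close> and the distribution charges every nonempty open set, it holds for
  \<^emph>\<open>every\<close> \<open>z\<close> (lemma \<open>midpoint_optimal_imp_pointwise_equality\<close>). The positive part bends at \<open>0\<close>, so
  equality rules out that \<open>g x\<close> and \<open>g y\<close> have strictly opposite signs at any point.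

  Both functions are affine in \<open>z\<close>. Two nonconstant affine functions that never have strictly
  opposite signs are positive multiples of each other, which forces \<open>y = r *\<^sub>R x\<close> with \<open>r > 0\<close> and,
  by comparing constant terms, \<open>(r - 1) * b1 = 0\<close> (lemma \<open>same_sign_imp_proportional\<close>). If \<open>b1 = 0\<close>,
  then the objective is positively homogeneous, so the values at \<open>x\<close> and \<open>y\<close> differ by the factor
  \<open>r\<close>; they are equal and positive, hence \<open>r = 1\<close> in every case. If one of the two points is \<open>0\<close>, its
  function is the constant \<open>- b1\<close>: either this is nonpositive and the optimal value would be \<open>0\<close>,
  or it is positive everywhere, whereas the function of the other point takes negative values.

  The argument compares integrals, so it needs them to be finite; this is where the sub-Gaussian
  tail enters (lemma \<open>sub_gaussian_imp_integrable_norm\<close>).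
\<close>

section \<open>Norms on a Euclidean space and their dual norms\<close>

lemma
  assumes "is_norm N"
  shows is_norm_zero: "N 0 = 0"
    and is_norm_scaleR: "N (r *\<^sub>R x) = \<bar>r\<bar> * N x"
    and is_norm_triangle: "N (x + y) \<le> N x + N y"
  using assms unfolding is_norm_def by blast+

lemma is_norm_nonneg:
  assumes "is_norm N"
  shows "0 \<le> N x"
proof -
  have "N 0 \<le> N x + N (- x)"
    using is_norm_triangle[OF assms, of x "- x"] by simp
  moreover have "N (- x) = N x"
    using is_norm_scaleR[OF assms, of "- 1" x] by simp
  ultimately show ?thesis by (simp add: is_norm_zero[OF assms])
qed

lemma is_norm_continuous:
  fixes N :: "'a::euclidean_space \<Rightarrow> real"
  assumes "is_norm N"
  shows "continuous_on UNIV N"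
proof (rule convex_on_continuous)
  show "convex_on UNIV N"
  proof (rule convex_onI)
    fix s :: real and x y :: 'a
    assume s: "0 < s" "s < 1"
    have "N ((1 - s) *\<^sub>R x + s *\<^sub>R y) \<le> N ((1 - s) *\<^sub>R x) + N (s *\<^sub>R y)"
      by (rule is_norm_triangle[OF assms])
    also have "\<dots> = (1 - s) * N x + s * N y"
      using s by (simp add: is_norm_scaleR[OF assms])
    finally show "N ((1 - s) *\<^sub>R x + s *\<^sub>R y) \<le> (1 - s) * N x + s * N y" .
  qed simp
qed simp

text \<open>All norms on a finite-dimensional space are equivalent; the proof minimizes \<open>N\<close> over the compact
  Euclidean unit sphere.\<close>

lemma is_norm_dominates_norm:
  fixes N :: "'a::euclidean_space \<Rightarrow> real"
  assumes N: "is_norm N"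
  obtains K where "K > 0" "\<And>z. norm z \<le> K * N z"
proof -
  have "sphere (0::'a) 1 \<noteq> {}" by simp
  moreover have "continuous_on (sphere 0 1) N"
    using is_norm_continuous[OF N] continuous_on_subset by blast
  ultimately obtain u where u: "u \<in> sphere 0 1" "\<And>w. w \<in> sphere 0 1 \<Longrightarrow> N u \<le> N w"
    using continuous_attains_inf[of "sphere 0 1" N] compact_sphere by blast
  have "u \<noteq> 0" using u(1) by auto
  then have pos: "N u > 0"
    using is_norm_nonneg[OF N, of u] N by (auto simp: is_norm_def less_le)
  have "norm z \<le> inverse (N u) * N z" for z
  proof (cases "z = 0")
    case True
    then show ?thesis by (simp add: is_norm_zero[OF N])
  next
    case False
    then have "N u \<le> N (inverse (norm z) *\<^sub>R z)"
      by (intro u(2)) simp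
    also have "\<dots> = inverse (norm z) * N z"
      by (simp add: is_norm_scaleR[OF N])
    finally show ?thesis using False pos by (simp add: field_simps)
  qed
  with pos show ?thesis by (intro that[of "inverse (N u)"]) auto
qed

text \<open>The dual norm is a supremum of reals, so every estimate below needs it to be a supremum over a
  bounded set.\<close>

lemma inner_le_dual_norm:
  fixes N :: "'a::euclidean_space \<Rightarrow> real"
  assumes "is_norm N" and "N z \<le> 1"
  shows "x \<bullet> z \<le> dual_norm N x"
proof -
  obtain K where K: "K > 0" "\<And>z. norm z \<le> K * N z"
    using is_norm_dominates_norm[OF assms(1)] by metis
  have "x \<bullet> w \<le> norm x * K" if "N w \<le> 1" for w
  proof -
    have "norm w \<le> K"
      using K(2)[of w] mult_left_mono[OF that, of K] K(1) by linarith
    then show ?thesis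
      using norm_cauchy_schwarz[of x w] mult_left_mono[of "norm w" K "norm x"] by simp
  qed
  then have "bdd_above ((\<lambda>z. x \<bullet> z) ` {z. N z \<le> 1})"
    by (intro bdd_aboveI[of _ "norm x * K"]) auto
  then show ?thesis
    unfolding dual_norm_def using assms(2) by (intro cSUP_upper) auto
qed

lemma dual_norm_least:
  fixes N :: "'a::euclidean_space \<Rightarrow> real"
  assumes "is_norm N" and "\<And>z. N z \<le> 1 \<Longrightarrow> x \<bullet> z \<le> B"
  shows "dual_norm N x \<le> B"
proof -
  have "0 \<in> {z. N z \<le> 1}" by (simp add: is_norm_zero[OF assms(1)])
  then show ?thesis
    unfolding dual_norm_def using assms(2) by (intro cSUP_least) auto
qed

lemma dual_norm_add:
  fixes N :: "'a::euclidean_space \<Rightarrow> real"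
  assumes "is_norm N"
  shows "dual_norm N (x + y) \<le> dual_norm N x + dual_norm N y"
  using assms
  by (intro dual_norm_least) (auto simp: inner_add_left intro!: add_mono inner_le_dual_norm)

lemma dual_norm_scaleR:
  fixes N :: "'a::euclidean_space \<Rightarrow> real"
  assumes N: "is_norm N" and r: "0 < r"
  shows "dual_norm N (r *\<^sub>R x) = r * dual_norm N x"
proof -
  have le: "dual_norm N (s *\<^sub>R w) \<le> s * dual_norm N w" if "0 < s" for s w
    using N that by (intro dual_norm_least) (auto intro!: mult_left_mono inner_le_dual_norm)
  have "dual_norm N (inverse r *\<^sub>R (r *\<^sub>R x)) \<le> inverse r * dual_norm N (r *\<^sub>R x)"
    using r by (intro le) simp
  then have "r * dual_norm N x \<le> dual_norm N (r *\<^sub>R x)"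
    using r by (simp add: field_simps)
  with le[OF r, of x] show ?thesis by simp
qed

section \<open>Sub-Gaussian tails give a finite first moment\<close>

text \<open>A nonnegative number is at most the number of naturals \<open>k \<ge> 0\<close> that do not exceed it. Taking
  means turns this into a bound by the sum of the tails at the naturals, and \<open>k\<^sup>2 \<ge> k\<close> bounds that sum by a
  geometric series.\<close>

lemma sub_gaussian_imp_integrable_norm:
  fixes N :: "'a::euclidean_space \<Rightarrow> real"
  assumes P: "prob_space P" and sets: "sets P = sets borel"
    and N: "is_norm N" and sg: "sub_gaussian N P"
  shows "integrable P norm"
proof -
  interpret prob_space P by (rule P)
  have [measurable_cong]: "sets P = sets borel" by (rule sets)
  have [measurable]: "N \<in> borel_measurable borel"
    by (rule borel_measurable_continuous_onI[OF is_norm_continuous[OF N]])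
  obtain C1 C2 where C: "C1 > 0" "C2 > 0"
      and tail: "\<And>\<tau>. \<tau> \<ge> 0 \<Longrightarrow> measure P {z. N z \<ge> \<tau>} \<le> C1 * exp (- C2 * \<tau>\<^sup>2)"
    using sg unfolding sub_gaussian_def by blast
  define q where "q = exp (- C2)"
  have q: "0 < q" "q < 1" using C by (auto simp: q_def)
  have count: "ennreal (N z) \<le> (\<Sum>k. indicator {z. N z \<ge> real k} z)" for z
  proof -
    define m where "m = nat \<lfloor>N z\<rfloor>"
    have m: "real m \<le> N z" "N z \<le> real (Suc m)"
      using is_norm_nonneg[OF N, of z] unfolding m_def by linarith+
    have "ennreal (N z) \<le> ennreal (real (Suc m))"
      using m(2) by (rule ennreal_leI)
    also have "\<dots> = (\<Sum>k<Suc m. 1)"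
      by (metis card_lessThan ennreal_of_nat_eq_real_of_nat of_nat_sum sum_constant mult.right_neutral
          of_nat_eq_id id_apply of_nat_1)
    also have "\<dots> = (\<Sum>k<Suc m. indicator {z. N z \<ge> real k} z)"
      using m(1) by (intro sum.cong) auto
    also have "\<dots> \<le> (\<Sum>k. indicator {z. N z \<ge> real k} z)"
      by (intro sum_le_suminf) auto
    finally show ?thesis .
  qed
  have tail_nat: "emeasure P {z. N z \<ge> real k} \<le> ennreal (C1 * q ^ k)" for k
  proof -
    have "real k \<le> (real k)\<^sup>2"
      by (cases k) (auto simp: power2_eq_square)
    then have "exp (- C2 * (real k)\<^sup>2) \<le> exp (real k * (- C2))"
      using C(2) by (simp add: mult.commute)
    also have "\<dots> = q ^ k" by (simp only: q_def exp_of_nat_mult)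
    finally have "C1 * exp (- C2 * (real k)\<^sup>2) \<le> C1 * q ^ k"
      using C(1) by simp
    then have "measure P {z. N z \<ge> real k} \<le> C1 * q ^ k"
      using tail[of "real k"] by simp
    then show ?thesis by (simp add: emeasure_eq_measure ennreal_leI)
  qed
  have "(\<integral>\<^sup>+z. ennreal (N z) \<partial>P) \<le> (\<integral>\<^sup>+z. (\<Sum>k. indicator {z. N z \<ge> real k} z) \<partial>P)"
    by (intro nn_integral_mono count)
  also have "\<dots> = (\<Sum>k. emeasure P {z. N z \<ge> real k})"
    by (subst nn_integral_suminf) (auto simp: sets)
  also have "\<dots> \<le> (\<Sum>k. ennreal (C1 * q ^ k))"
    by (intro suminf_le tail_nat) auto
  also have "\<dots> = ennreal (\<Sum>k. C1 * q ^ k)"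
    using q C by (intro suminf_ennreal2) (auto intro!: summable_mult summable_geometric)
  also have "\<dots> < \<infinity>" by simp
  finally have "integrable P N"
    using is_norm_nonneg[OF N] by (intro integrableI_nonneg) auto
  moreover obtain K where "K > 0" "\<And>z. norm z \<le> K * N z"
    using is_norm_dominates_norm[OF N] by metis
  ultimately show ?thesis
    by (intro Bochner_Integration.integrable_bound[of P "\<lambda>z. K * N z" norm])
      (auto intro!: AE_I2 order_trans[OF _ abs_ge_self])
qed

section \<open>Affine functions without opposite signs\<close>

text \<open>The constant terms carry \<open>h x\<close> and \<open>h y\<close> because the dual norm scales along with its argument:
  once \<open>y = r *\<^sub>R x\<close>, only \<open>b\<close> fails to scale, which is what pins down \<open>(r - 1) * b\<close>.\<close>

lemma same_sign_imp_proportional: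
  fixes x y :: "'a::real_inner" and h :: "'a \<Rightarrow> real"
  assumes hom: "\<And>r w. 0 < r \<Longrightarrow> h (r *\<^sub>R w) = r * h w"
    and nz: "x \<noteq> 0" "y \<noteq> 0"
    and xy: "\<And>z. h x + x \<bullet> z - b > 0 \<Longrightarrow> h y + y \<bullet> z - b \<ge> 0"
    and yx: "\<And>z. h y + y \<bullet> z - b > 0 \<Longrightarrow> h x + x \<bullet> z - b \<ge> 0"
  obtains r where "0 < r" "y = r *\<^sub>R x" "(r - 1) * b = 0"
proof -
  have xx: "x \<bullet> x > 0" using nz(1) by simp
  have reach: "\<exists>z. h x + x \<bullet> z - b = s" for s
    using xx by (intro exI[of _ "((s + b - h x) / (x \<bullet> x)) *\<^sub>R x"]) simp
  \<comment> \<open>A ray along which the first function stays positive cannot make the second tend to \<open>-\<infinity>\<close>.\<close>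
  have ray: "y \<bullet> w \<ge> 0" if w: "x \<bullet> w \<ge> 0" for w
  proof (rule ccontr)
    assume "\<not> y \<bullet> w \<ge> 0"
    then have neg: "y \<bullet> w < 0" by simp
    obtain z where z: "h x + x \<bullet> z - b = 1" using reach by blast
    define s where "s = (\<bar>h y + y \<bullet> z - b\<bar> + 1) / (- (y \<bullet> w))"
    have "s \<ge> 0" using neg by (simp add: s_def divide_nonneg_neg)
    then have "h x + x \<bullet> (z + s *\<^sub>R w) - b > 0"
      using z mult_nonneg_nonneg[OF _ w, of s] by (simp add: inner_add_right)
    from xy[OF this] have "h y + y \<bullet> z - b + s * (y \<bullet> w) \<ge> 0"
      by (simp add: inner_add_right)
    moreover have "s * (y \<bullet> w) = - (\<bar>h y + y \<bullet> z - b\<bar> + 1)"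
      using neg by (simp add: s_def)
    ultimately show False by linarith
  qed
  define r where "r = (y \<bullet> x) / (x \<bullet> x)"
  define u where "u = y - r *\<^sub>R x"
  have xu: "x \<bullet> u = 0"
    using xx by (simp add: u_def r_def inner_diff_right inner_commute)
  have "y \<bullet> (- u) \<ge> 0" using xu by (intro ray) simp
  moreover have "y \<bullet> u = u \<bullet> u"
    using xu by (simp add: u_def inner_diff_left inner_diff_right inner_commute algebra_simps)
  ultimately have "u \<bullet> u \<le> 0" by simp
  then have "u = 0" by (metis inner_eq_zero_iff inner_ge_zero order_antisym)
  then have y: "y = r *\<^sub>R x" by (simp add: u_def)
  have "r \<ge> 0" unfolding r_def using xx ray[of x] by simp
  then have r: "r > 0" using nz(2) y by (cases "r = 0") auto
  have scale: "h y + y \<bullet> z - b = r * (h x + x \<bullet> z - b) + (r - 1) * b" for z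
    using r by (simp add: y hom algebra_simps)
  define q where "q = (r - 1) * b"
  \<comment> \<open>Halfway between the zeros of the two functions, where the first equals \<open>- q / (2 * r)\<close>, the second equals
    \<open>q / 2\<close>; these have opposite signs unless \<open>q = 0\<close>.\<close>
  obtain z where z: "h x + x \<bullet> z - b = - (q / (2 * r))" using reach by blast
  have z': "h y + y \<bullet> z - b = q / 2"
    unfolding scale z q_def[symmetric] using r by simp
  have "\<not> 0 < q"
    using yx[of z] r unfolding z z' by (auto simp: zero_le_divide_iff divide_le_0_iff)
  moreover have "\<not> q < 0"
    using xy[of z] r unfolding z z' by (auto simp: divide_less_0_iff)
  ultimately have "(r - 1) * b = 0" by (simp add: q_def)
  with r y show ?thesis by (rule that)
qed

section \<open>Equality in the convexity inequality\<close>

lemma integrable_pos_part_affine: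
  fixes x :: "'a::euclidean_space"
  assumes "prob_space P" and sets: "sets P = sets borel" and int: "integrable P norm"
  shows "integrable P (\<lambda>z. pos_part (a + x \<bullet> z - b))"
proof -
  interpret prob_space P by fact
  have [measurable_cong]: "sets P = sets borel" by (rule sets)
  show ?thesis
  proof (rule Bochner_Integration.integrable_bound)
    show "integrable P (\<lambda>z. \<bar>a - b\<bar> + norm x * norm z)"
      using int by (intro Bochner_Integration.integrable_add integrable_mult_right) auto
    show "(\<lambda>z. pos_part (a + x \<bullet> z - b)) \<in> borel_measurable P"
      unfolding pos_part_def by measurable
    have "\<bar>pos_part (a + x \<bullet> z - b)\<bar> \<le> \<bar>a - b\<bar> + norm x * norm z" for z
      using Cauchy_Schwarz_ineq2[of x z] unfolding pos_part_def by linarith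
    then show "AE z in P. norm (pos_part (a + x \<bullet> z - b)) \<le> norm (\<bar>a - b\<bar> + norm x * norm z)"
      by (intro AE_I2) (simp add: order_trans[OF _ abs_ge_self])
  qed
qed

text \<open>The conclusion holds at every \<open>z\<close> and not only almost everywhere: the set where Jensen's
  inequality is strict is open, and the full support leaves no room for a nonempty open null set.\<close>

lemma midpoint_optimal_imp_pointwise_equality:
  fixes x y :: "'a::euclidean_space" and h :: "'a \<Rightarrow> real"
  assumes P: "prob_space P" and sets: "sets P = sets borel" and int: "integrable P norm"
    and supp: "topological_support P = UNIV"
    and mid: "2 * h m \<le> h x + h y" "2 *\<^sub>R m = x + y"
    and opt: "(\<integral>z. pos_part (h x + x \<bullet> z - b) \<partial>P) + (\<integral>z. pos_part (h y + y \<bullet> z - b) \<partial>P)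
      \<le> 2 * (\<integral>z. pos_part (h m + m \<bullet> z - b) \<partial>P)"
  shows "pos_part (h x + x \<bullet> z - b) + pos_part (h y + y \<bullet> z - b) = 2 * pos_part (h m + m \<bullet> z - b)"
proof -
  interpret prob_space P by (rule P)
  define d where "d z = pos_part (h x + x \<bullet> z - b) + pos_part (h y + y \<bullet> z - b)
      - 2 * pos_part (h m + m \<bullet> z - b)" for z
  note I = integrable_pos_part_affine[OF P sets int]
  have d_nonneg: "0 \<le> d z" for z
  proof -
    have "2 * (m \<bullet> z) = x \<bullet> z + y \<bullet> z"
      using mid(2) by (metis inner_add_left inner_scaleR_left)
    with mid(1) show ?thesis unfolding d_def pos_part_def max_def by (smt (verit))
  qed
  have d_int: "integrable P d" unfolding d_def
    by (intro Bochner_Integration.integrable_diff Bochner_Integration.integrable_add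
        integrable_mult_right I)
  have "(\<integral>z. d z \<partial>P) = (\<integral>z. pos_part (h x + x \<bullet> z - b) \<partial>P)
      + (\<integral>z. pos_part (h y + y \<bullet> z - b) \<partial>P) - 2 * (\<integral>z. pos_part (h m + m \<bullet> z - b) \<partial>P)"
    unfolding d_def by (simp add: I)
  moreover have "0 \<le> (\<integral>z. d z \<partial>P)" using d_nonneg by simp
  ultimately have "(\<integral>z. d z \<partial>P) = 0" using opt by linarith
  then have ae: "AE z in P. d z = 0"
    using integral_nonneg_eq_0_iff_AE[OF d_int] d_nonneg by simp
  have "continuous_on UNIV d"
    unfolding d_def pos_part_def by (intro continuous_intros)
  then have op: "open {z. 0 < d z}"
    by (intro open_Collect_less) auto
  have "measure P {z. 0 < d z} = 0"
  proof -
    have "emeasure P {z. 0 < d z} = 0"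
      using ae op by (subst AE_iff_measurable[symmetric, where P = "\<lambda>z. \<not> 0 < d z"])
        (auto simp: sets sets_eq_imp_space_eq[OF sets])
    then show ?thesis by (simp add: measure_def)
  qed
  then have "\<not> 0 < d z"
    using supp op unfolding topological_support_def by fastforce
  with d_nonneg[of z] show ?thesis by (simp add: d_def)
qed

section \<open>Uniqueness for a sublinear penalty\<close>

text \<open>The penalty \<open>h\<close> stands for the scaled dual norm. Sublinearity is what gives convexity of the
  objective in \<open>x\<close> and its homogeneity when \<open>b = 0\<close>.\<close>

lemma positive_minimizer_unique:
  fixes x y :: "'a::euclidean_space" and h :: "'a \<Rightarrow> real"
  defines "f \<equiv> \<lambda>b P x. \<integral>z. pos_part (h x + x \<bullet> z - b) \<partial>P"
  assumes P: "prob_space P" and sets: "sets P = sets borel" and int: "integrable P norm"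
    and supp: "topological_support P = UNIV"
    and sub: "\<And>u w. h (u + w) \<le> h u + h w"
    and hom: "\<And>r w. 0 < r \<Longrightarrow> h (r *\<^sub>R w) = r * h w"
    and mid: "f b P x \<le> f b P ((1 / 2) *\<^sub>R (x + y))"
    and eq: "f b P x = f b P y" and pos: "0 < f b P x"
  shows "x = y"
proof -
  define m where "m = (1 / 2) *\<^sub>R (x + y)"
  have m: "2 *\<^sub>R m = x + y" by (simp add: m_def)
  have hm: "2 * h m \<le> h x + h y" using hom[of "1/2" "x + y"] sub[of x y] by (simp add: m_def)
  have pointwise: "pos_part (h x + x \<bullet> z - b) + pos_part (h y + y \<bullet> z - b)
      = 2 * pos_part (h m + m \<bullet> z - b)" for z
    using mid eq unfolding f_def m_def[symmetric]
    by (intro midpoint_optimal_imp_pointwise_equality[OF P sets int supp hm m]) linarith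
  have m_inner: "2 * (m \<bullet> z) = x \<bullet> z + y \<bullet> z" for z
    using m by (metis inner_add_left inner_scaleR_left)
  have xy: "h y + y \<bullet> z - b \<ge> 0" if "h x + x \<bullet> z - b > 0" for z
    using that pointwise[of z] m_inner[of z] hm unfolding pos_part_def max_def by (smt (verit))
  have yx: "h x + x \<bullet> z - b \<ge> 0" if "h y + y \<bullet> z - b > 0" for z
    using that pointwise[of z] m_inner[of z] hm unfolding pos_part_def max_def by (smt (verit))
  have h0: "h 0 = 0" using hom[of 2 0] by simp
  have zero: "b < 0" if "0 < f b P 0"
  proof (rule ccontr)
    assume "\<not> b < 0"
    then have "f b P 0 = 0" by (simp add: f_def h0 pos_part_def)
    with that show False by simp
  qed
  have unbounded: "\<exists>z. h w + w \<bullet> z - b < 0" if "w \<noteq> 0" for w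
    using that by (intro exI[of _ "((b - h w - 1) / (w \<bullet> w)) *\<^sub>R w"]) simp
  show ?thesis
  proof (cases "x = 0 \<or> y = 0")
    case True
    then have b: "b < 0" using zero pos eq by auto
    from True show ?thesis
    proof
      assume x: "x = 0"
      then have "h y + y \<bullet> z - b \<ge> 0" for z using xy[of z] b by (simp add: h0)
      with unbounded[of y] x show ?thesis by (metis not_le)
    next
      assume y: "y = 0"
      then have "h x + x \<bullet> z - b \<ge> 0" for z using yx[of z] b by (simp add: h0)
      with unbounded[of x] y show ?thesis by (metis not_le)
    qed
  next
    case False
    then have nz: "x \<noteq> 0" "y \<noteq> 0" by auto
    obtain r where r: "0 < r" "y = r *\<^sub>R x" "(r - 1) * b = 0"
      using same_sign_imp_proportional[OF hom nz xy yx] .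
    have "r = 1"
    proof (cases "b = 0")
      case True
      have "pos_part (h y + y \<bullet> z - b) = r * pos_part (h x + x \<bullet> z - b)" for z
      proof -
        have "h y + y \<bullet> z - b = r * (h x + x \<bullet> z - b)"
          using r(1) by (simp add: r(2) hom True algebra_simps)
        then show ?thesis using r(1) by (simp add: pos_part_def max_mult_distrib_left)
      qed
      then have "f b P y = r * f b P x" by (simp add: f_def)
      with eq pos show ?thesis by simp
    qed (use r(3) in simp)
    with r(2) show ?thesis by simp
  qed
qed

section \<open>The lower-level problem\<close>

text \<open>When the linear program is unbounded below, some point of \<open>X\<close> lies strictly below the level;
  when it is bounded, the minimum is attained and a minimizer meets the level, even if only with
  equality.\<close>

lemma alsox_feasible_nonempty:
  assumes att: "attains_min (\<lambda>x. c \<bullet> x) X"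
    and le: "min_value (\<lambda>x. c \<bullet> x) X \<le> ereal t"
  shows "alsox_feasible c X t \<noteq> {}"
proof (cases "min_value (\<lambda>x. c \<bullet> x) X = -\<infinity>")
  case True
  then have "(INF x\<in>X. ereal (c \<bullet> x)) < ereal t" by (simp add: min_value_def)
  then obtain x where "x \<in> X" "c \<bullet> x < t" by (auto simp: INF_less_iff)
  then show ?thesis by (auto simp: alsox_feasible_def)
next
  case False
  have "X \<noteq> {}" using le by (auto simp: min_value_def top_ereal_def)
  then obtain x where x: "x \<in> X" "\<And>w. w \<in> X \<Longrightarrow> c \<bullet> x \<le> c \<bullet> w"
    using att False unfolding attains_min_def is_arg_min_linorder by blast
  then have "ereal (c \<bullet> x) \<le> min_value (\<lambda>x. c \<bullet> x) X"
    unfolding min_value_def by (intro INF_greatest) simp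
  with le have "c \<bullet> x \<le> t" using order_trans by fastforce
  with x(1) show ?thesis by (auto simp: alsox_feasible_def)
qed

lemma alsox_objective_nonneg: "0 \<le> alsox_objective N \<theta> b1 P x"
  by (simp add: alsox_objective_def pos_part_def)

lemma alsox_minimizer_exists:
  assumes "alsox_feasible c X t \<noteq> {}"
    and "attains_min (alsox_objective N \<theta> b1 P) (alsox_feasible c X t)"
  shows "\<exists>x. is_arg_min (alsox_objective N \<theta> b1 P) (\<lambda>x. x \<in> alsox_feasible c X t) x"
proof -
  have "ereal 0 \<le> min_value (alsox_objective N \<theta> b1 P) (alsox_feasible c X t)"
    unfolding min_value_def by (intro INF_greatest) (simp add: alsox_objective_nonneg)
  with assms show ?thesis unfolding attains_min_def by auto
qed

lemma convex_alsox_feasible: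
  assumes "convex X"
  shows "convex (alsox_feasible c X t)"
proof -
  have "alsox_feasible c X t = X \<inter> {x. c \<bullet> x \<le> t}" by (auto simp: alsox_feasible_def)
  with assms show ?thesis by (simp add: convex_Int convex_halfspace_le)
qed

theorem theorem5:
  fixes P :: "(real ^ 'n) measure"
    and N :: "real ^ 'n \<Rightarrow> real"
    and X :: "(real ^ 'n) set"
    and c :: "real ^ 'n"
    and \<theta> b1 p t :: real
  assumes "prob_space P"
    and "has_probability_density P"
    and "nondegenerate P"
    and "topological_support P = UNIV"
    and "is_norm N"
    and "sub_gaussian N P"
    and "1 < p"
    and "dual_norm N = lp_norm p"
    and "0 \<le> \<theta>"
    and "convex X"
    and "attains_min (\<lambda>x. c \<bullet> x) X"
    and "attains_min (alsox_objective N \<theta> b1 P) (alsox_feasible c X t)"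
    and "min_value (\<lambda>x. c \<bullet> x) X \<le> ereal t"
    and "alsox_value N \<theta> b1 P c X t > 0"
  shows "\<exists>!x. is_arg_min (alsox_objective N \<theta> b1 P) (\<lambda>x. x \<in> alsox_feasible c X t) x"
proof -
  let ?f = "alsox_objective N \<theta> b1 P" and ?S = "alsox_feasible c X t"
  define h where "h x = \<theta> * dual_norm N x" for x
  note N = \<open>is_norm N\<close>
  have f: "?f x = (\<integral>z. pos_part (h x + x \<bullet> z - b1) \<partial>P)" for x
    by (simp add: alsox_objective_def h_def)
  have sets: "sets P = sets borel"
    using \<open>has_probability_density P\<close> by (auto simp: has_probability_density_def)
  have int: "integrable P norm"
    using \<open>prob_space P\<close> sets N \<open>sub_gaussian N P\<close> by (rule sub_gaussian_imp_integrable_norm)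
  have sub: "h (u + w) \<le> h u + h w" for u w
    using mult_left_mono[OF dual_norm_add[OF N] \<open>0 \<le> \<theta>\<close>] by (simp add: h_def distrib_left)
  have hom: "h (r *\<^sub>R w) = r * h w" if "0 < r" for r w
    using that by (simp add: h_def dual_norm_scaleR[OF N])
  have ex: "\<exists>x. is_arg_min ?f (\<lambda>x. x \<in> ?S) x"
    using alsox_feasible_nonempty assms by (intro alsox_minimizer_exists) blast+
  have "x = y" if x: "is_arg_min ?f (\<lambda>x. x \<in> ?S) x" and y: "is_arg_min ?f (\<lambda>x. x \<in> ?S) y" for x y
  proof -
    have xS: "x \<in> ?S" "\<And>w. w \<in> ?S \<Longrightarrow> ?f x \<le> ?f w" and yS: "y \<in> ?S" "\<And>w. w \<in> ?S \<Longrightarrow> ?f y \<le> ?f w"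
      using x y by (auto simp: is_arg_min_linorder)
    have "(1 / 2) *\<^sub>R x + (1 / 2) *\<^sub>R y \<in> ?S"
      using convex_alsox_feasible[OF \<open>convex X\<close>] xS(1) yS(1) by (rule convexD) auto
    then have mid: "?f x \<le> ?f ((1 / 2) *\<^sub>R (x + y))"
      by (intro xS(2)) (simp add: scaleR_add_right)
    have "alsox_value N \<theta> b1 P c X t \<le> ereal (?f x)"
      unfolding alsox_value_def min_value_def using xS(1) by (rule INF_lower)
    with \<open>alsox_value N \<theta> b1 P c X t > 0\<close> have "0 < ereal (?f x)" by (rule less_le_trans)
    then have pos: "0 < ?f x" by simp
    have "?f x = ?f y" using xS yS by (intro antisym) auto
    with \<open>prob_space P\<close> sets int \<open>topological_support P = UNIV\<close> sub hom mid pos show ?thesis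
      unfolding f by (intro positive_minimizer_unique[where P = P and h = h and b = b1]) auto
  qed
  with ex show ?thesis by blast
qed

end
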